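(* Let $p$ be an odd prime number such that $p+2$ and $p+4$ are not prime and $p+6=5^{\alpha}$ for some natural number $\alpha$. Let $H$ and $T$ be any groups such that $|H|=p+6=5^{\alpha}$ and $|T|=2(p+6)$. Then: (1) $|A_{p+6}|=|A_{p+5}\times H|$ and $D(A_{p+6})=D(A_{p+5}\times H)$; (2) $|S_{p+6}|=|S_{p+5}\times H|$ and $D(S_{p+6})=D(S_{p+5}\times H)$; (3) $|S_{p+6}|=|A_{p+5}\times T|$ and $D(S_{p+6})=D(A_{p+5}\times T)$.
   Context: All groups are finite. $A_n$ and $S_n$ denote the alternating and symmetric groups of degree $n$. For a finite group $G$, $\pi(G)$ is the set of prime divisors of $|G|$. The prime graph $GK(G)$ is the graph with vertex set $\pi(G)$ in which two distinct primes $r,s\in\pi(G)$ are adjacent if and only if $G$ contains an element of order $rs$. Writing $\pi(G)=\{p_1,\ldots,p_k\}$ with $p_1<p_2<\cdots<p_k$, the degree pattern of $G$ is the tuple $D(G)=(\deg(p_1),\deg(p_2),\ldots,\deg(p_k))$, where $\deg(p_i)$ is the degree of the vertex $p_i$ in $GK(G)$. *)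

theory Defs
  imports
    "HOL-Algebra.Sym_Groups"
    "HOL-Algebra.Multiplicative_Group"
    "HOL-Computational_Algebra.Primes"
begin

text \<open>
  A simple graph is a pair of a vertex set and a set of two-element edges. The notions below are
  meant for finite groups \<open>G\<close>; the names of constants are qualified where HOL-Algebra and
  HOL-Computational_Algebra use the same base name.
\<close>

type_synonym 'v sgraph = "'v set \<times> 'v set set"

definition degree_in :: "'v sgraph \<Rightarrow> 'v \<Rightarrow> nat" where
  "degree_in \<Gamma> v = card {e \<in> snd \<Gamma>. v \<in> e}"

definition prime_divisors :: "('a, 'm) monoid_scheme \<Rightarrow> nat set" where
  "prime_divisors G = {r. Factorial_Ring.prime r \<and> r dvd Coset.order G}"

definition prime_graph :: "('a, 'm) monoid_scheme \<Rightarrow> nat sgraph" where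
  "prime_graph G =
     (prime_divisors G,
      {{r, s} | r s. r \<in> prime_divisors G \<and> s \<in> prime_divisors G \<and> r \<noteq> s \<and>
                     (\<exists>x \<in> carrier G. group.ord G x = r * s)})"

definition degree_pattern :: "('a, 'm) monoid_scheme \<Rightarrow> nat list" where
  "degree_pattern G =
     map (degree_in (prime_graph G)) (sorted_list_of_set (fst (prime_graph G)))"

end

theory Submission
  imports Defs
begin

text \<open>
  For distinct primes \<open>r\<close> and \<open>s\<close>, the symmetric group of degree \<open>n\<close> has an element of order
  \<open>r * s\<close> iff \<open>r + s \<le> n\<close>; the same holds for the alternating group as long as every odd prime
  \<open>s \<le> n\<close> satisfies \<open>s + 4 \<le> n\<close>, which leaves room for two transpositions next to an \<open>s\<close>-cycle.
  Here \<open>p\<close> is the largest prime up to \<open>p + 6\<close>, and no two primes have the odd sum \<open>p + 6\<close> because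
  \<open>p + 4\<close> is composite. So the degrees \<open>p + 5\<close> and \<open>p + 6\<close> give one and the same prime graph, in
  which \<open>2\<close> and \<open>5\<close> are adjacent to every other vertex. A direct factor whose order has no prime
  divisors besides \<open>2\<close> and \<open>5\<close> therefore adds neither vertices nor edges.
\<close>

section \<open>Orders of permutations\<close>

text \<open>The power with exponent \<open>k\<close> acts on the entries of \<open>cs\<close> as
  rotation by \<open>k\<close>. As the entries are distinct, comparing the heads shows that only
  rotations by multiples of the length are trivial.\<close>

lemma cycle_of_list_funpow_eq_id:
  assumes "cycle cs" and "cs \<noteq> []"
  shows "(cycle_of_list cs ^^ k) = id \<longleftrightarrow> length cs dvd k"
proof
  assume "(cycle_of_list cs ^^ k) = id"
  then have rot: "rotate k cs = cs"
    using cyclic_rotation[OF assms(1), of k] by simp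
  have "cs ! (k mod length cs) = cs ! 0"
    using nth_rotate[of 0 cs k] rot assms(2) by simp
  then have "k mod length cs = 0"
    using assms nth_eq_iff_index_eq[of cs "k mod length cs" 0] by simp
  then show "length cs dvd k" by auto
next
  assume "length cs dvd k"
  then have "map (cycle_of_list cs ^^ k) cs = cs"
    using cyclic_rotation[OF assms(1), of k] by (simp add: rotate_id)
  then have "(cycle_of_list cs ^^ k) x = x" if "x \<in> set cs" for x
    using that by (metis map_eq_conv map_ident)
  moreover have "(cycle_of_list cs ^^ k) x = x" if "x \<notin> set cs" for x
    using permutes_funpow[OF cycle_permutes] that by (metis permutes_not_in)
  ultimately show "(cycle_of_list cs ^^ k) = id" by fastforce
qed

text \<open>Permutations with disjoint supports commute, so the power of the product is the product
  of the powers. Each point is fixed by at least one of the two factors, hence neither can undo a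
  nontrivial move of the other.\<close>

lemma funpow_comp_disjoint_eq_id:
  assumes "f permutes A" and "g permutes B" and "A \<inter> B = {}"
  shows "((f \<circ> g) ^^ k) = id \<longleftrightarrow> (f ^^ k) = id \<and> (g ^^ k) = id"
proof -
  have comm: "f (g x) = g (f x)" for x
    using assms by (metis disjoint_iff permutes_in_image permutes_not_in)
  have *: "(g ^^ k) (f x) = f ((g ^^ k) x)" for k x
    by (induction k) (simp_all add: comm)
  have "((f \<circ> g) ^^ k) x = (f ^^ k) ((g ^^ k) x)" for k x
    by (induction k arbitrary: x) (simp_all add: funpow_Suc_right * del: funpow.simps(2))
  then have eq: "((f \<circ> g) ^^ k) = (f ^^ k) \<circ> (g ^^ k)"
    by (simp add: fun_eq_iff)
  have fA: "(f ^^ k) permutes A" and gB: "(g ^^ k) permutes B"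
    using assms permutes_funpow by blast+
  show ?thesis
  proof
    assume "((f \<circ> g) ^^ k) = id"
    then have h: "(f ^^ k) ((g ^^ k) x) = x" for x
      using eq by (metis comp_apply id_apply)
    have "(f ^^ k) x = x" for x
      using h fA gB assms(3) by (metis disjoint_iff permutes_not_in)
    then show "(f ^^ k) = id \<and> (g ^^ k) = id"
      using h by (auto simp: fun_eq_iff)
  qed (simp add: eq)
qed

text \<open>An odd power has the same sign as \<open>f\<close> itself, and the identity is
  even.\<close>

lemma evenperm_if_odd_funpow_eq_id:
  assumes "permutation f" and "odd d" and "(f ^^ d) = id"
  shows "evenperm f"
proof -
  have "evenperm (f ^^ k) \<longleftrightarrow> evenperm f \<or> even k" for k
    using assms(1) by (induction k) (auto simp: evenperm_comp permutation_funpow)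
  then show ?thesis
    using assms by (metis evenperm_id)
qed

section \<open>Element orders in symmetric and alternating groups as statements about
  iteration\<close>

lemma sym_group_pow: "f [^]\<^bsub>sym_group n\<^esub> (k :: nat) = f ^^ k"
proof -
  interpret group "sym_group n" by (rule sym_group_is_group)
  show ?thesis
    by (induction k)
      (simp_all only: nat_pow_0 nat_pow_Suc sym_group_one sym_group_mult funpow_0 funpow.simps(1) funpow_Suc_right)
qed

lemma alt_group_pow: "f [^]\<^bsub>alt_group n\<^esub> (k :: nat) = f ^^ k"
proof -
  interpret group "alt_group n" by (rule alt_group_is_group)
  show ?thesis
    by (induction k)
      (simp_all only: nat_pow_0 nat_pow_Suc alt_group_one alt_group_mult funpow_0 funpow.simps(1) funpow_Suc_right)
qed

text \<open>Characterising the order by all exponents with trivial power, not by a least one,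
  matches the shape of the facts on cycles and disjoint products.\<close>

lemma sym_group_ord_eq:
  assumes "f permutes {1..n}"
  shows "group.ord (sym_group n) f = d \<longleftrightarrow> (\<forall>k. (f ^^ k) = id \<longleftrightarrow> d dvd k)"
  using group.ord_unique[OF sym_group_is_group, of f n d] assms
  unfolding sym_group_carrier sym_group_one sym_group_pow by simp

lemma alt_group_ord_eq:
  assumes "f permutes {1..n}" and "evenperm f"
  shows "group.ord (alt_group n) f = d \<longleftrightarrow> (\<forall>k. (f ^^ k) = id \<longleftrightarrow> d dvd k)"
  using group.ord_unique[OF alt_group_is_group, of f n d] assms
  unfolding alt_group_carrier alt_group_one alt_group_pow by simp

section \<open>Elements of prescribed order, and a bound on the degree they require\<close>

lemma ex_permutation_of_order:
  assumes "d > 0" and "a + d \<le> n"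
  obtains f where "f permutes {a+1..a+d}" "\<And>k. (f ^^ k) = id \<longleftrightarrow> d dvd k"
    "odd d \<Longrightarrow> evenperm f"
proof -
  \<comment> \<open>A \<open>d\<close>-cycle on the block right after the first \<open>a\<close>
    points, which stay free for a disjoint factor.\<close>
  let ?cs = "[a+1..<a+d+1]"
  let ?f = "cycle_of_list ?cs"
  have id: "(?f ^^ k) = id \<longleftrightarrow> d dvd k" for k
    using cycle_of_list_funpow_eq_id[of ?cs k] assms by simp
  have perm: "?f permutes {a+1..a+d}"
    using cycle_permutes[of ?cs] by (simp add: atLeastLessThanSuc_atLeastAtMost del: upt_Suc)
  show thesis
  proof (rule that[OF perm id])
    show "evenperm ?f" if "odd d"
      by (rule evenperm_if_odd_funpow_eq_id[OF permutation_of_cycle that]) (simp only: id dvd_refl)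
  qed
qed

text \<open>Composing \<open>f\<close> with an \<open>s\<close>-cycle on the next \<open>s\<close>
  points works: a power is trivial iff \<open>r\<close> and \<open>s\<close> both divide the
  exponent, and by coprimality this means that \<open>r * s\<close> does.\<close>

lemma ex_permutation_of_coprime_order:
  assumes "f permutes {1..a}" and "\<And>k. (f ^^ k) = id \<longleftrightarrow> r dvd k"
    and "coprime r s" and "s > 0" and "a + s \<le> n"
  obtains g where "g permutes {1..n}" "\<And>k. (g ^^ k) = id \<longleftrightarrow> r * s dvd k"
    "evenperm f \<Longrightarrow> odd s \<Longrightarrow> evenperm g"
proof -
  obtain h where h: "h permutes {a+1..a+s}" "\<And>k. (h ^^ k) = id \<longleftrightarrow> s dvd k"
    "odd s \<Longrightarrow> evenperm h"
    using ex_permutation_of_order[OF assms(4,5)] by metis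
  have "((f \<circ> h) ^^ k) = id \<longleftrightarrow> r * s dvd k" for k
    using funpow_comp_disjoint_eq_id[OF assms(1) h(1)] assms(2,3) h(2)
    by (auto intro: divides_mult dvd_mult_left dvd_mult_right)
  moreover have "(f \<circ> h) permutes {1..n}"
    using assms(1,5) h(1) by (intro permutes_compose) (auto elim!: permutes_subset)
  moreover have "evenperm (f \<circ> h)" if "evenperm f" "odd s"
    using evenperm_comp[of f h] assms(1) h(1,3) that permutation_permutes by blast
  ultimately show thesis using that by blast
qed

lemma sym_group_ex_ord:
  assumes "coprime r s" and "r > 0" and "s > 0" and "r + s \<le> n"
  shows "\<exists>x \<in> carrier (sym_group n). group.ord (sym_group n) x = r * s"
proof -
  obtain f where f: "f permutes {1..r}" "\<And>k. (f ^^ k) = id \<longleftrightarrow> r dvd k"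
    using ex_permutation_of_order[of r 0 n] assms by auto
  show ?thesis
    using ex_permutation_of_coprime_order[OF f assms(1,3,4)]
    by (metis sym_group_carrier sym_group_ord_eq)
qed

lemma alt_group_ex_ord_odd:
  assumes "coprime r s" and "odd r" and "odd s" and "r + s \<le> n"
  shows "\<exists>x \<in> carrier (alt_group n). group.ord (alt_group n) x = r * s"
proof -
  have pos: "r > 0" "s > 0" using assms odd_pos by auto
  obtain f where f: "f permutes {1..r}" "\<And>k. (f ^^ k) = id \<longleftrightarrow> r dvd k" "evenperm f"
    using ex_permutation_of_order[of r 0 n] assms pos by auto
  show ?thesis
    using ex_permutation_of_coprime_order[OF f(1,2) assms(1) pos(2) assms(4)] f(3) assms(3)
    by (metis alt_group_carrier alt_group_ord_eq)
qed

lemma alt_group_ex_ord_even: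
  assumes "odd s" and "s + 4 \<le> n"
  shows "\<exists>x \<in> carrier (alt_group n). group.ord (alt_group n) x = 2 * s"
proof -
  \<comment> \<open>A single transposition is odd; two disjoint ones give an even involution on four
    points, whence the bound \<open>s + 4\<close>.\<close>
  let ?f = "transpose 1 (2::nat) \<circ> transpose 3 4"
  have id: "(transpose a b ^^ k) = id \<longleftrightarrow> 2 dvd k" if "a \<noteq> b" for a b k :: nat
    using cycle_of_list_funpow_eq_id[of "[a, b]" k] that by (simp flip: numeral_2_eq_2)
  have perm: "transpose 1 2 permutes {1..2::nat}" "transpose 3 4 permutes {3..4::nat}"
    by (auto intro: permutes_swap_id)
  have f: "?f permutes {1..4}"
    using perm by (intro permutes_compose) (auto elim!: permutes_subset)
  have "(?f ^^ k) = id \<longleftrightarrow> 2 dvd k" for k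
    using funpow_comp_disjoint_eq_id[OF perm] id by simp
  moreover have "evenperm ?f"
    by (simp add: evenperm_comp permutation_swap_id evenperm_swap)
  moreover have "coprime 2 s" using assms(1) by simp
  ultimately show ?thesis
    using ex_permutation_of_coprime_order[OF f, of 2 s n] assms odd_pos[of s]
    by (metis add.commute alt_group_carrier alt_group_ord_eq)
qed

text \<open>
  A point moved by \<open>f ^^ s\<close> lies in an orbit of length divisible by \<open>r\<close>, a point moved by
  \<open>f ^^ r\<close> in one of length divisible by \<open>s\<close>. The two orbits are disjoint, or coincide and then
  have at least \<open>r * s\<close> elements.
\<close>
lemma permutation_order_prime_mult_le:
  assumes perm: "f permutes {1..n}"
    and ord: "\<And>k. (f ^^ k) = id \<longleftrightarrow> r * s dvd k"
    and r: "Factorial_Ring.prime (r::nat)" and s: "Factorial_Ring.prime s" and "r \<noteq> s"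
  shows "r + s \<le> n"
proof -
  have permf: "permutation f" using perm permutation_permutes by blast
  have fin: "finite (set (support f z))" for z by simp
  \<comment> \<open>\<open>support f z\<close> lists the orbit of \<open>z\<close>, and
    \<open>least_power f z\<close> is its length.\<close>
  have card: "card (set (support f z)) = least_power f z" for z
    using distinct_card[OF cycle_of_permutation[OF permf, of z]] by simp
  have dvd: "least_power f z dvd r * s" for z
    using least_power_minimal ord by (metis dvd_refl id_apply)
  have gt1: "r > 1" "s > 1" using r s prime_gt_1_nat by auto
  have sub: "set (support f z) \<subseteq> {1..n}" if "z \<in> {1..n}" for z
    using that permutes_funpow[OF perm] by (auto simp: permutes_in_image simp del: atLeastAtMost_iff)
  \<comment> \<open>Since \<open>t\<close> is a proper divisor of \<open>r * s\<close>, some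
    \<open>z\<close> is moved by \<open>f ^^ t\<close>. Its orbit length divides
    \<open>q * t\<close> but not \<open>t\<close>, so it cannot be coprime to the prime
    \<open>q\<close>.\<close>
  have *: "\<exists>z \<in> {1..n}. q dvd least_power f z"
    if "r * s = q * t" "t > 0" "Factorial_Ring.prime q" for q t
  proof -
    have "q > 1" using that prime_gt_1_nat by auto
    then have "\<not> r * s dvd t" using that by (auto dest: dvd_imp_le)
    then obtain z where z: "(f ^^ t) z \<noteq> z" using ord by (metis eq_id_iff)
    have "\<not> least_power f z dvd t" using z least_power_dvd[OF permf] by blast
    then have "q dvd least_power f z"
      using dvd[of z] that prime_imp_coprime[of q "least_power f z"]
      by (metis coprime_commute coprime_dvd_mult_right_iff)
    moreover have "z \<in> {1..n}"
      using z permutes_funpow[OF perm] permutes_not_in by metis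
    ultimately show ?thesis by blast
  qed
  obtain x where x: "x \<in> {1..n}" "r dvd least_power f x" using *[of r s] r gt1 by auto
  obtain y where y: "y \<in> {1..n}" "s dvd least_power f y" using *[of s r] s gt1 by auto
  have pos: "least_power f z > 0" for z using least_power_of_permutation[OF permf] by blast
  show ?thesis
  proof (cases "set (support f x) \<inter> set (support f y) = {}")
    case True
    have "r + s \<le> least_power f x + least_power f y"
      using x y pos by (intro add_mono dvd_imp_le) simp_all
    also have "\<dots> = card (set (support f x) \<union> set (support f y))"
      using True card by (simp only: card_Un_disjoint[OF fin fin True])
    also have "\<dots> \<le> card {1..n}"
      using sub x y by (intro card_mono) auto
    finally show ?thesis by simp
  next
    case False
    have "disjoint (range (\<lambda>z. set (support f z)))"
      using disjoint_support[OF permf] .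
    with False have "set (support f x) = set (support f y)"
      unfolding disjoint_def by blast
    then have "least_power f x = least_power f y" using card by metis
    then have "r * s dvd least_power f x"
      using x y primes_coprime[OF r s \<open>r \<noteq> s\<close>] by (simp add: divides_mult)
    then have "r * s \<le> card (set (support f x))"
      using card pos dvd_imp_le by metis
    also have "\<dots> \<le> card {1..n}" using sub x by (intro card_mono) auto
    finally have "r * s \<le> n" by simp
    moreover have "r + s \<le> r * s"
    proof -
      \<comment> \<open>With this substitution the product exceeds the sum by
        \<open>a * b + a + b\<close>.\<close>
      obtain a b where "r = a + 2" "s = b + 2"
        using gt1 by (metis Suc_1 Suc_leI add.commute le_iff_add)
      then show ?thesis by (simp add: algebra_simps)
    qed
    ultimately show ?thesis by simp
  qed
qed

section \<open>Prime graphs\<close>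

text \<open>A purely arithmetical graph to which every prime graph in the proof is reduced, so that
  comparing groups becomes comparing sums of primes.\<close>

definition prime_sum_graph :: "nat \<Rightarrow> nat sgraph" where
  "prime_sum_graph n =
     ({r. Factorial_Ring.prime r \<and> r \<le> n},
      {{r, s} | r s. Factorial_Ring.prime r \<and> Factorial_Ring.prime s \<and> r \<noteq> s \<and> r + s \<le> n})"

text \<open>The bound \<open>r + s \<le> n\<close> already makes both ends vertices, so the
  criterion on orders has to be checked only for primes up to \<open>n\<close>.\<close>

lemma prime_graph_eqI:
  assumes "prime_divisors G = {r. Factorial_Ring.prime r \<and> r \<le> n}"
    and "\<And>r s. Factorial_Ring.prime r \<Longrightarrow> Factorial_Ring.prime s \<Longrightarrow> r \<noteq> s \<Longrightarrow> r \<le> n \<Longrightarrow> s \<le> n \<Longrightarrow>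
           (\<exists>x \<in> carrier G. group.ord G x = r * s) \<longleftrightarrow> r + s \<le> n"
  shows "prime_graph G = prime_sum_graph n"
proof -
  have "(r \<in> prime_divisors G \<and> s \<in> prime_divisors G \<and> r \<noteq> s \<and>
          (\<exists>x \<in> carrier G. group.ord G x = r * s)) \<longleftrightarrow>
        (Factorial_Ring.prime r \<and> Factorial_Ring.prime s \<and> r \<noteq> s \<and> r + s \<le> n)" for r s
    using assms(2)[of r s] unfolding assms(1) by auto
  then show ?thesis
    unfolding prime_graph_def prime_sum_graph_def assms(1)[symmetric] by simp
qed

lemma order_sym_group: "Coset.order (sym_group n) = fact n"
  by (simp add: Coset.order_def sym_group_card_carrier)

lemma order_alt_group: "n \<ge> 2 \<Longrightarrow> 2 * Coset.order (alt_group n) = fact n"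
  by (simp add: Coset.order_def alt_group_card_carrier)

lemma prime_graph_sym_group: "prime_graph (sym_group n) = prime_sum_graph n"
proof (rule prime_graph_eqI)
  show "prime_divisors (sym_group n) = {r. Factorial_Ring.prime r \<and> r \<le> n}"
    unfolding prime_divisors_def order_sym_group using prime_dvd_fact_iff by blast
next
  fix r s :: nat
  assume "Factorial_Ring.prime r" "Factorial_Ring.prime s" "r \<noteq> s"
  then show "(\<exists>x \<in> carrier (sym_group n). group.ord (sym_group n) x = r * s) \<longleftrightarrow> r + s \<le> n"
    using permutation_order_prime_mult_le sym_group_ex_ord primes_coprime prime_gt_0_nat
    by (metis sym_group_carrier sym_group_ord_eq)
qed

text \<open>Halving \<open>fact n\<close> does not affect odd primes, and for
  \<open>n \<ge> 4\<close> it leaves a factor 2 because 4 divides \<open>fact n\<close>.\<close>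

lemma prime_divisors_alt_group:
  assumes "n \<ge> 4"
  shows "prime_divisors (alt_group n) = {r. Factorial_Ring.prime r \<and> r \<le> n}"
proof -
  have ord: "2 * Coset.order (alt_group n) = fact n"
    using order_alt_group assms by simp
  have "2 * 2 dvd (fact 4 :: nat)" by (simp add: fact_numeral)
  also have "fact 4 dvd (fact n :: nat)" using assms fact_dvd by blast
  finally have two: "2 dvd Coset.order (alt_group n)" using ord by (metis dvd_times_left_cancel_iff zero_neq_numeral)
  have "r dvd Coset.order (alt_group n) \<longleftrightarrow> r \<le> n" if "Factorial_Ring.prime r" for r
  proof (cases "r = 2")
    case True
    then show ?thesis using two assms by simp
  next
    case False
    then have "\<not> r dvd 2" using that primes_dvd_imp_eq two_is_prime_nat by blast
    then have "r dvd Coset.order (alt_group n) \<longleftrightarrow> r dvd 2 * Coset.order (alt_group n)"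
      using that prime_dvd_mult_iff by blast
    then show ?thesis using ord that prime_dvd_fact_iff by metis
  qed
  then show ?thesis unfolding prime_divisors_def by blast
qed

lemma prime_graph_alt_group:
  assumes "n \<ge> 4"
    and gap: "\<And>s. Factorial_Ring.prime s \<Longrightarrow> odd s \<Longrightarrow> s \<le> n \<Longrightarrow> s + 4 \<le> n"
  shows "prime_graph (alt_group n) = prime_sum_graph n"
proof (rule prime_graph_eqI[OF prime_divisors_alt_group[OF assms(1)]])
  fix r s :: nat
  assume r: "Factorial_Ring.prime r" "r \<le> n" and s: "Factorial_Ring.prime s" "s \<le> n"
    and "r \<noteq> s"
  show "(\<exists>x \<in> carrier (alt_group n). group.ord (alt_group n) x = r * s) \<longleftrightarrow> r + s \<le> n"
  proof
    assume "\<exists>x \<in> carrier (alt_group n). group.ord (alt_group n) x = r * s"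
    then show "r + s \<le> n"
      using permutation_order_prime_mult_le[OF _ _ r(1) s(1) \<open>r \<noteq> s\<close>]
      by (metis alt_group_carrier alt_group_ord_eq)
  next
    assume le: "r + s \<le> n"
    \<comment> \<open>At most one of two distinct primes is 2. Two odd cycles are even without
      correction; \<open>gap\<close> is called on only when 2 occurs.\<close>
    consider "odd r" "odd s" | "r = 2" "odd s" | "s = 2" "odd r"
      using r s \<open>r \<noteq> s\<close> prime_odd_nat prime_ge_2_nat by (metis le_neq_implies_less)
    then show "\<exists>x \<in> carrier (alt_group n). group.ord (alt_group n) x = r * s"
    proof cases
      case 1
      then show ?thesis
        using alt_group_ex_ord_odd le primes_coprime[OF r(1) s(1) \<open>r \<noteq> s\<close>] by blast
    next
      case 2
      then show ?thesis using alt_group_ex_ord_even gap s by blast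
    next
      case 3
      then show ?thesis using alt_group_ex_ord_even[of r n] gap r by (simp add: mult.commute)
    qed
  qed
qed

section \<open>Direct products\<close>

lemma order_DirProd: "Coset.order (G \<times>\<times> H) = Coset.order G * Coset.order H"
  by (simp add: Coset.order_def card_cartesian_product)

lemma DirProd_pow:
  assumes "group G" and "group H"
  shows "(a, b) [^]\<^bsub>G \<times>\<times> H\<^esub> (k :: nat) = (a [^]\<^bsub>G\<^esub> k, b [^]\<^bsub>H\<^esub> k)"
  using assms DirProd_group[OF assms]
  by (induction k) (simp_all add: monoid.nat_pow_0 monoid.nat_pow_Suc group.is_monoid)

text \<open>The order of a pair is the least common multiple of the two orders, expressed here by
  its divisibility property.\<close>

lemma DirProd_ord_eq:
  assumes "group G" and "group H" and "a \<in> carrier G" and "b \<in> carrier H"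
  shows "group.ord (G \<times>\<times> H) (a, b) = d \<longleftrightarrow>
    (\<forall>k. group.ord G a dvd k \<and> group.ord H b dvd k \<longleftrightarrow> d dvd k)"
  using group.ord_unique[OF DirProd_group[OF assms(1,2)], of "(a, b)" d] assms
  by (simp add: DirProd_pow[OF assms(1,2)] group.pow_eq_id)

text \<open>By \<open>adj\<close>, a prime dividing the order of \<open>H\<close> is already joined
  to every other vertex, and by \<open>le\<close> it is already a vertex. Any new edge would
  therefore have to avoid these primes, and then it comes from \<open>G\<close> alone.\<close>

lemma prime_graph_DirProd:
  assumes G: "group G" and H: "group H"
    and graph: "prime_graph G = prime_sum_graph n"
    and H0: "Coset.order H > 0"
    and adj: "\<And>r s. Factorial_Ring.prime r \<Longrightarrow> r dvd Coset.order H \<Longrightarrow>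
       Factorial_Ring.prime s \<Longrightarrow> s \<le> n \<Longrightarrow> r \<noteq> s \<Longrightarrow> r + s \<le> n"
    and le: "\<And>r. Factorial_Ring.prime r \<Longrightarrow> r dvd Coset.order H \<Longrightarrow> r \<le> n"
  shows "prime_graph (G \<times>\<times> H) = prime_sum_graph n"
proof (rule prime_graph_eqI)
  have \<pi>: "prime_divisors G = {r. Factorial_Ring.prime r \<and> r \<le> n}"
    using graph by (simp add: prime_graph_def prime_sum_graph_def)
  show "prime_divisors (G \<times>\<times> H) = {r. Factorial_Ring.prime r \<and> r \<le> n}"
    using \<pi> le by (auto simp: prime_divisors_def order_DirProd prime_dvd_mult_iff)
  fix r s :: nat
  assume r: "Factorial_Ring.prime r" "r \<le> n" and s: "Factorial_Ring.prime s" "s \<le> n"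
    and "r \<noteq> s"
  \<comment> \<open>Equality of graphs is turned back into the criterion on element orders; an edge
    is an unordered pair, so both orders of \<open>r\<close> and \<open>s\<close> have to be
    matched.\<close>
  have edge: "(\<exists>a \<in> carrier G. group.ord G a = r * s) \<longleftrightarrow> r + s \<le> n"
  proof -
    have "(\<exists>a \<in> carrier G. group.ord G a = r * s) \<longleftrightarrow> {r, s} \<in> snd (prime_graph G)"
      using r s \<open>r \<noteq> s\<close> \<pi> by (auto simp: prime_graph_def doubleton_eq_iff mult.commute)
    also have "\<dots> \<longleftrightarrow> r + s \<le> n"
      unfolding graph using r s \<open>r \<noteq> s\<close>
      by (auto simp: prime_sum_graph_def doubleton_eq_iff add.commute)
    finally show ?thesis .
  qed
  show "(\<exists>x \<in> carrier (G \<times>\<times> H). group.ord (G \<times>\<times> H) x = r * s) \<longleftrightarrow> r + s \<le> n"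
  proof
    assume "\<exists>x \<in> carrier (G \<times>\<times> H). group.ord (G \<times>\<times> H) x = r * s"
    then obtain a b where a: "a \<in> carrier G" and b: "b \<in> carrier H"
      and ord: "\<And>k. group.ord G a dvd k \<and> group.ord H b dvd k \<longleftrightarrow> r * s dvd k"
      using DirProd_ord_eq[OF G H] by auto
    have b_dvd: "group.ord H b dvd Coset.order H"
      using group.ord_dvd_group_order[OF H b] .
    show "r + s \<le> n"
    proof (cases "r dvd Coset.order H \<or> s dvd Coset.order H")
      case True
      then show ?thesis
        using adj r s \<open>r \<noteq> s\<close> by (metis add.commute)
    next
      case False
      \<comment> \<open>The order of \<open>b\<close> divides two coprime numbers, so
        \<open>b\<close> contributes nothing and \<open>a\<close> alone has order
        \<open>r * s\<close>.\<close>
      then have "coprime (r * s) (Coset.order H)"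
        using r s prime_imp_coprime by (metis coprime_mult_left_iff)
      moreover have "group.ord H b dvd r * s" using ord[of "r * s"] by simp
      ultimately have "group.ord H b = 1"
        using b_dvd by (metis coprime_def nat_dvd_1_iff_1)
      then have "group.ord G a dvd k \<longleftrightarrow> r * s dvd k" for k using ord by auto
      then have "group.ord G a = r * s" by (meson dvd_antisym dvd_refl)
      then show ?thesis using edge a by blast
    qed
  next
    assume "r + s \<le> n"
    then obtain a where a: "a \<in> carrier G" "group.ord G a = r * s" using edge by blast
    have one: "\<one>\<^bsub>H\<^esub> \<in> carrier H" using H by (simp add: group.is_monoid)
    have "group.ord (G \<times>\<times> H) (a, \<one>\<^bsub>H\<^esub>) = r * s"
      using DirProd_ord_eq[OF G H a(1) one] a(2) group.ord_id[OF H] by simp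
    then show "\<exists>x \<in> carrier (G \<times>\<times> H). group.ord (G \<times>\<times> H) x = r * s"
      using a one by (intro bexI[of _ "(a, \<one>\<^bsub>H\<^esub>)"]) auto
  qed
qed

section \<open>Arithmetic around \<open>p + 6\<close> and comparison of the groups\<close>

theorem theorem1p6:
  fixes p \<alpha> :: nat
    and H :: "('h, 'm) monoid_scheme"
    and T :: "('t, 'n) monoid_scheme"
  assumes "Factorial_Ring.prime p" and "odd p"
    and "\<not> Factorial_Ring.prime (p + 2)" and "\<not> Factorial_Ring.prime (p + 4)"
    and "p + 6 = 5 ^ \<alpha>"
    and "group H" and "Coset.order H = p + 6"
    and "group T" and "Coset.order T = 2 * (p + 6)"
  shows
    "(Coset.order (alt_group (p + 6)) = Coset.order (alt_group (p + 5) \<times>\<times> H) \<and>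
      degree_pattern (alt_group (p + 6)) = degree_pattern (alt_group (p + 5) \<times>\<times> H)) \<and>
     (Coset.order (sym_group (p + 6)) = Coset.order (sym_group (p + 5) \<times>\<times> H) \<and>
      degree_pattern (sym_group (p + 6)) = degree_pattern (sym_group (p + 5) \<times>\<times> H)) \<and>
     (Coset.order (sym_group (p + 6)) = Coset.order (alt_group (p + 5) \<times>\<times> T) \<and>
      degree_pattern (sym_group (p + 6)) = degree_pattern (alt_group (p + 5) \<times>\<times> T))"
proof -
  have p3: "p \<ge> 3"
    using assms(1,2) prime_ge_2_nat[of p] by (cases "p = 2") auto
  have not_prime6: "\<not> Factorial_Ring.prime (p + 6)"
  proof
    assume "Factorial_Ring.prime (p + 6)"
    \<comment> \<open>A prime that is a power of 5 is 5 itself, which is smaller than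
      \<open>p + 6\<close>.\<close>
    then have "\<alpha> = 1" using assms(5) by (metis prime_power_iff)
    then show False using assms(5) by simp
  qed
  have le_p: "s \<le> p" if "Factorial_Ring.prime s" "s \<le> p + 6" for s
  proof (rule ccontr)
    assume "\<not> s \<le> p"
    \<comment> \<open>Parity rules out \<open>p + 1\<close>, \<open>p + 3\<close> and
      \<open>p + 5\<close>, the hypotheses rule out \<open>p + 2\<close> and \<open>p + 4\<close>,
      and \<open>not_prime6\<close> the last candidate.\<close>
    with that(2) have "s \<in> {p+1, p+2, p+3, p+4, p+5, p+6}" by auto
    moreover have "odd s"
      using that(1) \<open>\<not> s \<le> p\<close> p3 by (intro prime_odd_nat) simp_all
    ultimately show False using that(1) assms(2-4) not_prime6 by auto
  qed
  have sum_le: "r + s \<le> p + 5"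
    if rs: "Factorial_Ring.prime r" "Factorial_Ring.prime s" "r + s \<le> p + 6" for r s
  proof (rule ccontr)
    assume "\<not> r + s \<le> p + 5"
    then have eq: "r + s = p + 6" using rs by simp
    then have "odd (r + s)" using assms(2) by simp
    then have "r = 2 \<or> s = 2"
      using primes_dvd_imp_eq[OF two_is_prime_nat rs(1)] primes_dvd_imp_eq[OF two_is_prime_nat rs(2)]
      by auto
    then have "s = p + 4 \<or> r = p + 4" using eq by auto
    then show False using rs assms(4) by auto
  qed
  have graph_eq: "prime_sum_graph (p + 5) = prime_sum_graph (p + 6)"
  proof -
    have "Factorial_Ring.prime r \<and> r \<le> p + 5 \<longleftrightarrow> Factorial_Ring.prime r \<and> r \<le> p + 6" for r
      using le_p[of r] by auto
    moreover have "Factorial_Ring.prime r \<and> Factorial_Ring.prime s \<and> r \<noteq> s \<and> r + s \<le> p + 5 \<longleftrightarrow>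
      Factorial_Ring.prime r \<and> Factorial_Ring.prime s \<and> r \<noteq> s \<and> r + s \<le> p + 6" for r s
      using sum_le[of r s] by auto
    ultimately show ?thesis unfolding prime_sum_graph_def by simp
  qed
  have gap: "s + 4 \<le> p + 5" if "Factorial_Ring.prime s" "s \<le> p + 6" for s
    using le_p[OF that] by simp
  have alt6: "prime_graph (alt_group (p + 6)) = prime_sum_graph (p + 5)"
    unfolding graph_eq
  proof (rule prime_graph_alt_group)
    show "s + 4 \<le> p + 6" if "Factorial_Ring.prime s" "s \<le> p + 6" for s
      using gap[OF that] by simp
  qed simp
  have alt5: "prime_graph (alt_group (p + 5)) = prime_sum_graph (p + 5)"
  proof (rule prime_graph_alt_group)
    show "s + 4 \<le> p + 5" if "Factorial_Ring.prime s" "s \<le> p + 5" for s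
      using gap[OF that(1)] that(2) by simp
  qed simp
  have sym6: "prime_graph (sym_group (p + 6)) = prime_sum_graph (p + 5)"
    unfolding graph_eq by (rule prime_graph_sym_group)
  \<comment> \<open>\<open>2 * (p + 6)\<close> is the order of \<open>T\<close> and a multiple of
    the order of \<open>H\<close>, so this fact serves both factors.\<close>
  have small: "r = 2 \<or> r = 5"
    if "Factorial_Ring.prime r" "r dvd 2 * (p + 6)" for r
  proof -
    have "r dvd 2 \<or> r dvd 5"
      using that assms(5) prime_dvd_mult_iff prime_dvd_power by metis
    moreover have "Factorial_Ring.prime (5::nat)" by simp
    ultimately show ?thesis
      using that(1) primes_dvd_imp_eq two_is_prime_nat by blast
  qed
  have le: "r \<le> 5" if "Factorial_Ring.prime r" "r dvd 2 * (p + 6)" for r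
    using small[OF that] by auto
  \<comment> \<open>Here \<open>r \<le> 5\<close> and \<open>s \<le> p\<close>; the extreme case 5
    and \<open>p\<close> meets the bound exactly.\<close>
  have adj: "r + s \<le> p + 5"
    if "Factorial_Ring.prime r" "r dvd 2 * (p + 6)" "Factorial_Ring.prime s" "s \<le> p + 5" for r s
    using le[OF that(1,2)] le_p[OF that(3)] that(4) by simp
  have prod_H: "prime_graph (G \<times>\<times> H) = prime_sum_graph (p + 5)"
    if "group G" "prime_graph G = prime_sum_graph (p + 5)" for G :: "(nat \<Rightarrow> nat) monoid"
  proof (rule prime_graph_DirProd[OF that(1) assms(6) that(2)], unfold assms(7))
    show "r + s \<le> p + 5"
      if "Factorial_Ring.prime r" "r dvd p + 6" "Factorial_Ring.prime s" "s \<le> p + 5" for r s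
      using that by (intro adj dvd_mult)
    show "r \<le> p + 5" if "Factorial_Ring.prime r" "r dvd p + 6" for r
      using le[OF that(1) dvd_mult[OF that(2)]] by simp
  qed simp
  have prod_T: "prime_graph (G \<times>\<times> T) = prime_sum_graph (p + 5)"
    if "group G" "prime_graph G = prime_sum_graph (p + 5)" for G :: "(nat \<Rightarrow> nat) monoid"
  proof (rule prime_graph_DirProd[OF that(1) assms(8) that(2)], unfold assms(9))
    show "r + s \<le> p + 5"
      if "Factorial_Ring.prime r" "r dvd 2 * (p + 6)" "Factorial_Ring.prime s" "s \<le> p + 5" for r s
      using that by (intro adj)
    show "r \<le> p + 5" if "Factorial_Ring.prime r" "r dvd 2 * (p + 6)" for r
      using le[OF that] by simp
  qed simp
  \<comment> \<open>A degree pattern depends only on the prime graph, and all the graphs involved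
    are \<open>prime_sum_graph (p + 5)\<close>.\<close>
  have pats:
    "degree_pattern (alt_group (p + 6)) = degree_pattern (alt_group (p + 5) \<times>\<times> H)"
    "degree_pattern (sym_group (p + 6)) = degree_pattern (sym_group (p + 5) \<times>\<times> H)"
    "degree_pattern (sym_group (p + 6)) = degree_pattern (alt_group (p + 5) \<times>\<times> T)"
    unfolding degree_pattern_def alt6 sym6 prod_H[OF alt_group_is_group alt5]
      prod_H[OF sym_group_is_group prime_graph_sym_group] prod_T[OF alt_group_is_group alt5]
    by (rule refl)+
  have f: "fact (p + 6) = (p + 6) * (fact (p + 5) :: nat)"
    using fact_reduce[of "p + 6", where 'a = nat] by (simp add: add.commute)
  have a6: "2 * Coset.order (alt_group (p + 6)) = fact (p + 6)"
    and a5: "2 * Coset.order (alt_group (p + 5)) = fact (p + 5)"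
    by (simp_all add: order_alt_group)
  have "Coset.order (alt_group (p + 6)) = Coset.order (alt_group (p + 5) \<times>\<times> H)"
    using a6 unfolding order_DirProd assms(7) f a5[symmetric] by (simp add: mult.commute)
  moreover have "Coset.order (sym_group (p + 6)) = Coset.order (sym_group (p + 5) \<times>\<times> H)"
    unfolding order_DirProd assms(7) order_sym_group f by simp
  \<comment> \<open>The factor 2 in the order of \<open>T\<close> makes up for the index of the
    alternating group.\<close>
  moreover have "Coset.order (sym_group (p + 6)) = Coset.order (alt_group (p + 5) \<times>\<times> T)"
    unfolding order_DirProd assms(9) order_sym_group f a5[symmetric] by simp
  ultimately show ?thesis using pats by blast
qed

end
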